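(* Let $\mathcal{A}$ be a complex Banach algebra with identity $1$ and let $a\in\mathcal{A}$. The following statements are equivalent. (1) $a\in\mathcal{A}^{ad}$, i.e. $a$ is ag-Drazin invertible. (2) $a$ is acc-quasi-polar. (3) There exists an idempotent $p\in\{a\}'$ such that $a+p\in\mathcal{A}^{d}$ and $ap\in\mathcal{A}^{acc}$. (4) There exists an idempotent $f\in\{a\}'$ such that, with respect to $f$, $a=\begin{pmatrix} a_1 & 0\\ 0 & a_2\end{pmatrix}_f$, where $a_1$ is invertible in $f\mathcal{A}f$ and $a_2\in\big((1-f)\mathcal{A}(1-f)\big)^{acc}$. (5) There exists an idempotent $f\in\{a\}'$ such that $a(1-f)\in\mathcal{A}^{acc}$ and $af+1-f$ is invertible in $\mathcal{A}$.
   Context: For a complex Banach algebra $\mathcal{A}$ with identity $1$ and $a\in\mathcal{A}$: $\sigma(a)$ is the spectrum of $a$; $\{a\}'=\{b\in\mathcal{A}: ab=ba\}$; $\mathcal{A}^{qnil}=\{a\in\mathcal{A}:\sigma(a)=\{0\}\}$ is the set of quasinilpotent elements. An element $a$ is generalized Drazin invertible if there exists $x\in\{a\}'$ with $xax=x$ and $a-a^2x\in\mathcal{A}^{qnil}$; $\mathcal{A}^{d}$ is the set of all such elements. Define $\mathcal{A}^{acc}=\{a\in\mathcal{A}: a-\lambda 1\in\mathcal{A}^{d}\text{ for all }\lambda\in\mathbb{C}\setminus\{0\}\}$. An element $a$ is ag-Drazin invertible if there exists $x\in\{a\}'$ with $xax=x$ and $a-a^2x\in\mathcal{A}^{acc}$;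 $\mathcal{A}^{ad}$ is the set of all such elements. An element $a$ is acc-quasi-polar if there exists an idempotent $q\in\{a\}'$ such that $q\in a\mathcal{A}\cap\mathcal{A}a$ and $a(1-q)\in\mathcal{A}^{acc}$. For an idempotent $f\in\mathcal{A}$, the matrix notation $a=\begin{pmatrix} a_1 & a_2\\ a_3 & a_4\end{pmatrix}_f$ means $a_1=faf$, $a_2=fa(1-f)$, $a_3=(1-f)af$, $a_4=(1-f)a(1-f)$, so that $a$ is the sum of the four entries. The corner algebras $f\mathcal{A}f$ and $(1-f)\mathcal{A}(1-f)$ are Banach algebras with identities $f$ and $1-f$ respectively, and the set $(\cdot)^{acc}$ for a corner algebra is defined with respect to that algebra and its own identity. If a corner algebra is the zero algebra, its only element is regarded as invertible, as quasinilpotent, and as belonging to $(\cdot)^{acc}$. *)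

theory Defs
  imports Complex_Main
begin

text \<open>
  Unital complex Banach algebras. Neither \<open>norm 1 = 1\<close> nor \<open>1 \<noteq> 0\<close> is required,
  so the class is built on \<open>monoid_mult\<close> rather than on \<open>real_normed_algebra_1\<close>.
\<close>

class complex_banach_algebra_1 = banach + real_normed_algebra + monoid_mult +
  fixes scaleC :: "complex \<Rightarrow> 'a \<Rightarrow> 'a" (infixr "*\<^sub>C" 75)
  assumes scaleC_add_right: "c *\<^sub>C (x + y) = c *\<^sub>C x + c *\<^sub>C y"
    and scaleC_add_left: "(c + d) *\<^sub>C x = c *\<^sub>C x + d *\<^sub>C x"
    and scaleC_scaleC: "c *\<^sub>C (d *\<^sub>C x) = (c * d) *\<^sub>C x"
    and scaleC_one: "1 *\<^sub>C x = x"
    and scaleC_of_real: "complex_of_real r *\<^sub>C x = r *\<^sub>R x"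
    and mult_scaleC_left: "(c *\<^sub>C x) * y = c *\<^sub>C (x * y)"
    and mult_scaleC_right: "x * (c *\<^sub>C y) = c *\<^sub>C (x * y)"
    and norm_scaleC: "norm (c *\<^sub>C x) = cmod c * norm x"

text \<open>
  The following notions are relative to a subalgebra \<open>S\<close> of the ambient algebra having its
  own identity \<open>e\<close>. They are used for the whole algebra (\<open>S = UNIV\<close>, \<open>e = 1\<close>) and for
  corner algebras (\<open>S = corner f\<close>, \<open>e = f\<close>).
\<close>

definition invertible_in :: "'a::complex_banach_algebra_1 set \<Rightarrow> 'a \<Rightarrow> 'a \<Rightarrow> bool" where
  "invertible_in S e a \<longleftrightarrow> a \<in> S \<and> (\<exists>b\<in>S. a * b = e \<and> b * a = e)"

definition alg_spectrum :: "'a::complex_banach_algebra_1 set \<Rightarrow> 'a \<Rightarrow> 'a \<Rightarrow> complex set" where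
  "alg_spectrum S e a = {l. \<not> invertible_in S e (a - l *\<^sub>C e)}"

definition commutant :: "'a::complex_banach_algebra_1 set \<Rightarrow> 'a \<Rightarrow> 'a set" where
  "commutant S a = {b \<in> S. a * b = b * a}"

text \<open>
  In the zero algebra the spectrum is empty; its only element counts as quasinilpotent.
\<close>

definition qnil :: "'a::complex_banach_algebra_1 set \<Rightarrow> 'a \<Rightarrow> 'a set" where
  "qnil S e = {a \<in> S. alg_spectrum S e a = {0} \<or> S = {0}}"

definition gDrazin :: "'a::complex_banach_algebra_1 set \<Rightarrow> 'a \<Rightarrow> 'a set" where
  "gDrazin S e = {a \<in> S. \<exists>x \<in> commutant S a. x * a * x = x \<and> a - a\<^sup>2 * x \<in> qnil S e}"

definition acc :: "'a::complex_banach_algebra_1 set \<Rightarrow> 'a \<Rightarrow> 'a set" where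
  "acc S e = {a \<in> S. \<forall>l. l \<noteq> 0 \<longrightarrow> a - l *\<^sub>C e \<in> gDrazin S e}"

definition agDrazin :: "'a::complex_banach_algebra_1 set \<Rightarrow> 'a \<Rightarrow> 'a set" where
  "agDrazin S e = {a \<in> S. \<exists>x \<in> commutant S a. x * a * x = x \<and> a - a\<^sup>2 * x \<in> acc S e}"

definition idempotent :: "'a::complex_banach_algebra_1 \<Rightarrow> bool" where
  "idempotent q \<longleftrightarrow> q * q = q"

definition acc_quasi_polar :: "'a::complex_banach_algebra_1 \<Rightarrow> bool" where
  "acc_quasi_polar a \<longleftrightarrow>
     (\<exists>q \<in> commutant UNIV a. idempotent q \<and>
        q \<in> range (\<lambda>x. a * x) \<inter> range (\<lambda>x. x * a) \<and> a * (1 - q) \<in> acc UNIV 1)"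

definition corner :: "'a::complex_banach_algebra_1 \<Rightarrow> 'a set" where
  "corner f = range (\<lambda>x. f * x * f)"

definition matrix_rep ::
    "'a::complex_banach_algebra_1 \<Rightarrow> 'a \<Rightarrow> 'a \<Rightarrow> 'a \<Rightarrow> 'a \<Rightarrow> 'a \<Rightarrow> bool" where
  "matrix_rep f a a1 a2 a3 a4 \<longleftrightarrow>
     a1 = f * a * f \<and> a2 = f * a * (1 - f) \<and>
     a3 = (1 - f) * a * f \<and> a4 = (1 - f) * a * (1 - f)"

end

theory Submission
  imports Defs "HOL-Analysis.Analysis"
begin

text \<open>
  All five conditions say that the algebra splits along an idempotent \<open>f\<close> commuting with \<open>a\<close>
  so that \<open>a\<close> is invertible on the corner of \<open>f\<close> and lies in \<open>acc\<close> on the complementary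
  corner. If \<open>x\<close> is an ag-Drazin inverse of \<open>a\<close>, then \<open>f = a * x\<close>, and \<open>x\<close> is the inverse
  of \<open>a * f\<close> in the corner of \<open>f\<close>; conversely any such corner inverse is an ag-Drazin inverse
  (\<open>agDrazin_iff_splitting\<close>). For acc-quasi-polarity, for the matrix form and for the
  invertibility of \<open>a * f + 1 - f\<close> what remains is ring computation, provided that
  invertibility, generalized Drazin invertibility and membership in \<open>acc\<close> pass between a
  corner and the whole algebra. That passage, and the perturbation \<open>a + p\<close>, are where the
  Banach algebra enters.

  Two operations govern the passage. An element \<open>w\<close> commuting with an idempotent \<open>p\<close> can be
  cut to \<open>w * p\<close> in the corner of \<open>p\<close>, and an element of the corner can be glued to an
  invertible element of the complementary corner; both preserve generalized Drazin
  invertibility (\<open>gDrazin_cut\<close>, \<open>gDrazin_glue\<close>). Applied to \<open>s - \<mu> *\<^sub>C 1\<close> with \<open>\<mu> \<noteq> 0\<close>, whose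
  part outside the corner is the invertible \<open>- \<mu> *\<^sub>C (1 - p)\<close>, they show that \<open>acc\<close> of a corner
  is the trace of \<open>acc\<close> of the algebra (\<open>acc_corner\<close>). In the perturbation statement,
  \<open>a + p\<close> with \<open>p = 1 - f\<close> consists of \<open>a * f\<close> and \<open>a * p + p\<close>. The latter is \<open>a * p\<close>
  shifted by \<open>\<mu> = - 1\<close>, which gives one direction. For the other, cutting \<open>a + p\<close> to the
  corner of \<open>1 - p\<close> provides a generalized Drazin inverse of \<open>a * (1 - p)\<close> there, which turns
  out to be an ag-Drazin inverse of \<open>a\<close>.

  Cutting requires that everything commuting with \<open>w\<close> commute with its generalized Drazin
  inverses; and quasinilpotency of an element of a corner must include that \<open>0\<close> belongs to its
  spectrum there, that is, that the spectrum is nonempty. Both follow from one analytic fact: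
  if all \<open>v - \<mu> *\<^sub>C 1\<close> with \<open>\<mu> \<noteq> 0\<close> are invertible, then \<open>r ^ n * norm (v ^ n)\<close> tends to \<open>0\<close> for
  every \<open>r\<close> (\<open>quasinilpotent_powers\<close>), so that an equation \<open>T = x * T * v\<close>, iterated, forces
  \<open>T = 0\<close>. The proof of this fact is Rickart's elementary one, which replaces Cauchy's
  integral formula by finite averages of the resolvent over roots of unity.
\<close>

section \<open>Complex scalars\<close>

interpretation scaleC: vector_space
  "scaleC :: complex \<Rightarrow> 'a \<Rightarrow> 'a::complex_banach_algebra_1"
  by standard (simp_all add: scaleC_add_right scaleC_add_left scaleC_scaleC scaleC_one)

section \<open>Powers of quasinilpotent elements\<close>

lemma geometric_sum_times_one_minus:
  fixes b :: "'a::complex_banach_algebra_1"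
  shows "(\<Sum>j<n. b ^ j) * (1 - b) = 1 - b ^ n"
proof (induction n)
  case (Suc n)
  have "(\<Sum>j<Suc n. b ^ j) * (1 - b) = (1 - b ^ n) + b ^ n * (1 - b)"
    by (simp add: distrib_right Suc)
  also have "\<dots> = 1 - b ^ Suc n"
    by (simp add: right_diff_distrib power_Suc2 del: power_Suc)
  finally show ?case .
qed simp

lemma power_scaleC:
  fixes b :: "'a::complex_banach_algebra_1"
  shows "(z *\<^sub>C b) ^ n = z ^ n *\<^sub>C b ^ n"
  by (induction n) (simp_all add: scaleC_one mult_scaleC_left mult_scaleC_right scaleC_scaleC)

lemma sum_powers_root_of_unity:
  assumes "j < N" "0 < j"
  shows "(\<Sum>k<N. cis (2 * pi * real k / real N) ^ j) = 0"
proof -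
  define w where "w = cis (2 * pi * real j / real N)"
  have "cis (2 * pi * real k / real N) ^ j = w ^ k" for k
    unfolding w_def Complex.DeMoivre by (simp add: mult_ac)
  moreover have "w \<noteq> 1"
  proof
    assume "w = 1"
    then obtain m where m: "2 * pi * real j / real N = 2 * pi * of_int m"
      by (auto simp: w_def cis_conv_exp complex_exp_exists exp_eq_1)
    then have "real j = real_of_int m * real N"
      using assms by (simp add: field_simps)
    then have "int j = m * int N"
      by (metis of_int_eq_iff of_int_mult of_int_of_nat_eq)
    then show False
      using assms by (metis dvd_triv_right int_dvd_int_iff nat_dvd_not_less)
  qed
  moreover have "w ^ N = 1"
  proof -
    have "real N * (2 * pi * real j / real N) = 2 * pi * real j"
      using assms by simp
    then show ?thesis
      unfolding w_def Complex.DeMoivre by (simp add: cis_multiple_2pi)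
  qed
  ultimately show ?thesis
    using geometric_sum[of w N] by simp
qed

text \<open>
  This stands in for Cauchy's formula: averaging the geometric series of \<open>w *\<^sub>C b\<close> over the points
  \<open>w\<close> with \<open>w ^ N = z ^ N\<close> removes every power of \<open>b\<close> not divisible by \<open>N\<close>, so the average
  of the resolvents of \<open>b\<close> is the resolvent of \<open>b ^ N\<close>. Hence bounds on \<open>R\<close> over a circle bound
  the resolvents of all powers of \<open>b\<close> at once.
\<close>

lemma resolvent_average_is_inverse:
  fixes b :: "'a::complex_banach_algebra_1"
  assumes R: "\<And>z. (1 - z *\<^sub>C b) * R z = 1" and N: "N > 0"
  shows "(1 - z ^ N *\<^sub>C b ^ N) *
    ((1 / real N) *\<^sub>R (\<Sum>k<N. R (cis (2 * pi * real k / real N) * z))) = 1"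
proof -
  define c where "c k = cis (2 * pi * real k / real N)" for k
  have cN: "c k ^ N = 1" for k
    using N unfolding c_def Complex.DeMoivre by simp
  \<comment> \<open>Each factor \<open>1 - (c k * z) *\<^sub>C b\<close> divides \<open>1 - z ^ N *\<^sub>C b ^ N\<close>, with a finite geometric sum as quotient.\<close>
  have one: "(1 - z ^ N *\<^sub>C b ^ N) * R (c k * z) = (\<Sum>j<N. (c k ^ j * z ^ j) *\<^sub>C b ^ j)" for k
  proof -
    have "1 - z ^ N *\<^sub>C b ^ N = 1 - ((c k * z) *\<^sub>C b) ^ N"
      by (simp add: power_scaleC power_mult_distrib cN)
    also have "\<dots> * R (c k * z) = (\<Sum>j<N. ((c k * z) *\<^sub>C b) ^ j)"
      by (simp add: geometric_sum_times_one_minus[symmetric] mult.assoc R)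
    finally show ?thesis by (simp add: power_scaleC power_mult_distrib)
  qed
  have "(1 - z ^ N *\<^sub>C b ^ N) * (\<Sum>k<N. R (c k * z))
      = (\<Sum>k<N. \<Sum>j<N. (c k ^ j * z ^ j) *\<^sub>C b ^ j)"
    by (simp add: sum_distrib_left one)
  also have "\<dots> = (\<Sum>j<N. ((\<Sum>k<N. c k ^ j) * z ^ j) *\<^sub>C b ^ j)"
    by (subst sum.swap) (simp add: scaleC.scale_sum_left sum_distrib_right)
  also have "\<dots> = (\<Sum>j<N. if j = 0 then of_nat N *\<^sub>C 1 else 0)"
    by (rule sum.cong) (auto simp: c_def sum_powers_root_of_unity)
  also have "\<dots> = real N *\<^sub>R 1"
    using N scaleC_of_real[of "real N" "1::'a"] by (simp add: sum.delta)
  finally show ?thesis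
    using N by (simp add: c_def)
qed

text \<open>
  The resolvent identity \<open>R z - R w = (z - w) *\<^sub>C (R z * b * R w)\<close> yields everything: near \<open>w\<close> it
  absorbs \<open>norm (R z)\<close> and so gives local boundedness and continuity; compactness of the disc then
  gives a uniform bound, and the identity again turns this bound into a Lipschitz constant.
\<close>

lemma resolvent_Lipschitz_on_discs:
  fixes b :: "'a::complex_banach_algebra_1"
  assumes R1: "\<And>z. (1 - z *\<^sub>C b) * R z = 1" and R2: "\<And>z. R z * (1 - z *\<^sub>C b) = 1"
  shows "\<exists>M L. 0 \<le> M \<and> 0 \<le> L \<and> (\<forall>z\<in>cball 0 r. norm (R z) \<le> M) \<and>
    (\<forall>z\<in>cball 0 r. \<forall>w\<in>cball 0 r. norm (R z - R w) \<le> L * cmod (z - w))"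
proof -
  have id: "R z - R w = (z - w) *\<^sub>C (R z * b * R w)" for z w
  proof -
    have "R z - R w = R z * ((1 - w *\<^sub>C b) * R w) - (R z * (1 - z *\<^sub>C b)) * R w"
      by (simp add: R1 R2)
    also have "\<dots> = R z * ((z - w) *\<^sub>C b) * R w"
      by (simp add: algebra_simps scaleC.scale_left_diff_distrib)
    finally show ?thesis by (simp add: mult_scaleC_left mult_scaleC_right)
  qed
  have nid: "norm (R z - R w) \<le> cmod (z - w) * (norm (R z) * norm b * norm (R w))" for z w
    unfolding id norm_scaleC
    by (intro mult_left_mono order.trans[OF norm_mult_ineq] mult_right_mono norm_mult_ineq) auto
  have cont: "isCont R w" for w
  proof -
    define K where "K = norm b * norm (R w)"
    have K0: "0 \<le> K" by (simp add: K_def)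
    have "eventually (\<lambda>z. cmod (z - w) < 1 / (2 * (K + 1))) (at w)"
      using K0 by (auto simp: eventually_at dist_norm intro!: exI[of _ "1 / (2 * (K + 1))"])
    then have "eventually (\<lambda>z. norm (R z - R w) \<le> cmod (z - w) * (2 * norm (R w) * K)) (at w)"
    proof eventually_elim
      case (elim z)
      have "cmod (z - w) * K \<le> 1 / 2"
      proof -
        have "cmod (z - w) * K \<le> 1 / (2 * (K + 1)) * (K + 1)"
          using elim K0 by (intro mult_mono) auto
        also have "\<dots> = 1 / 2" using K0 by (simp add: field_simps)
        finally show ?thesis .
      qed
      then have "norm (R z) * (cmod (z - w) * K) \<le> norm (R z) * (1 / 2)"
        by (intro mult_left_mono) auto
      moreover have "norm (R z) \<le> norm (R w) + norm (R z - R w)"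
        by (metis add.commute diff_add_cancel norm_triangle_ineq)
      ultimately have "norm (R z) \<le> 2 * norm (R w)"
        using nid[of z w] by (simp add: K_def algebra_simps)
      then have "norm (R z) * K \<le> 2 * norm (R w) * K"
        using K0 by (rule mult_right_mono)
      then have "cmod (z - w) * (norm (R z) * K) \<le> cmod (z - w) * (2 * norm (R w) * K)"
        by (rule mult_left_mono) auto
      with nid[of z w] show ?case by (simp add: K_def mult.assoc)
    qed
    moreover have "((\<lambda>z. cmod (z - w) * (2 * norm (R w) * K)) \<longlongrightarrow> 0) (at w)"
      by (rule tendsto_eq_intros refl | simp)+
    ultimately have "((\<lambda>z. R z - R w) \<longlongrightarrow> 0) (at w)"
      by (rule Lim_null_comparison)
    then show ?thesis by (simp add: isCont_def LIM_zero_iff)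
  qed
  then have "compact (R ` cball 0 r)"
    by (intro compact_continuous_image continuous_at_imp_continuous_on) auto
  then obtain M where M: "\<And>z. z \<in> cball 0 r \<Longrightarrow> norm (R z) \<le> M" "0 < M"
    by (metis bounded_pos compact_imp_bounded imageI)
  have "norm (R z - R w) \<le> (M * norm b * M) * cmod (z - w)"
    if "z \<in> cball 0 r" "w \<in> cball 0 r" for z w
  proof -
    have "norm (R z) * norm b * norm (R w) \<le> M * norm b * M"
      using M that by (intro mult_mono) auto
    then have "cmod (z - w) * (norm (R z) * norm b * norm (R w)) \<le> cmod (z - w) * (M * norm b * M)"
      by (rule mult_left_mono) auto
    with nid[of z w] show ?thesis by (simp add: mult_ac)
  qed
  with M show ?thesis
    by (intro exI[of _ M] exI[of _ "M * norm b * M"]) auto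
qed

text \<open>
  The averages \<open>A N\<close> below are the inverses of \<open>1 - z ^ N *\<^sub>C b ^ N\<close>, and on a disc they inherit from
  \<open>R\<close> a bound and a Lipschitz constant that do not depend on \<open>N\<close>. Where \<open>t ^ n * norm (b ^ n)\<close>
  tends to \<open>0\<close>, \<open>A n t\<close> tends to \<open>1\<close>; by the uniform Lipschitz constant \<open>A n t'\<close> is then close to
  \<open>1\<close> for \<open>t'\<close> within a fixed distance \<open>\<delta>\<close> of \<open>t\<close>, which bounds \<open>t' ^ n * norm (b ^ n)\<close> and makes
  \<open>s ^ n * norm (b ^ n)\<close> vanish for \<open>s < t'\<close>. Since \<open>\<delta>\<close> does not shrink, finitely many such
  steps lead from \<open>0\<close> to \<open>r\<close>.
\<close>

lemma powers_vanish_of_resolvent: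
  fixes b :: "'a::complex_banach_algebra_1"
  assumes R1: "\<And>z. (1 - z *\<^sub>C b) * R z = 1" and R2: "\<And>z. R z * (1 - z *\<^sub>C b) = 1"
    and r: "r \<ge> 0"
  shows "(\<lambda>n. r ^ n * norm (b ^ n)) \<longlonglongrightarrow> 0"
proof -
  \<comment> \<open>The last step still needs some \<open>t'\<close> beyond \<open>r\<close>, hence the disc of radius \<open>r + 1\<close>.\<close>
  obtain M L where bnd: "0 \<le> M" "0 \<le> L"
      "\<And>z. z \<in> cball 0 (r + 1) \<Longrightarrow> norm (R z) \<le> M"
      "\<And>z w. z \<in> cball 0 (r + 1) \<Longrightarrow> w \<in> cball 0 (r + 1) \<Longrightarrow> norm (R z - R w) \<le> L * cmod (z - w)"
    using resolvent_Lipschitz_on_discs[OF R1 R2, of "r + 1"] by metis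
  define c where "c N k = cis (2 * pi * real k / real N)" for N k
  define A where "A N z = (1 / real N) *\<^sub>R (\<Sum>k<N. R (c N k * z))" for N z
  have A_inv: "(1 - z ^ N *\<^sub>C b ^ N) * A N z = 1" if "N > 0" for N z
    unfolding A_def c_def by (rule resolvent_average_is_inverse[OF R1 that])
  have in_disc: "c N k * z \<in> cball 0 (r + 1)" if "z \<in> cball 0 (r + 1)" for N k z
    using that by (simp add: c_def norm_mult)
  have A_bound: "norm (A N z) \<le> M" if "N > 0" "z \<in> cball 0 (r + 1)" for N z
  proof -
    have "norm (\<Sum>k<N. R (c N k * z)) \<le> (\<Sum>k<N. M)"
      by (intro sum_norm_le bnd in_disc that)
    then show ?thesis using that by (simp add: A_def field_simps)
  qed
  have A_Lip: "norm (A N z - A N w) \<le> L * cmod (z - w)"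
    if "N > 0" "z \<in> cball 0 (r + 1)" "w \<in> cball 0 (r + 1)" for N z w
  proof -
    have "norm (R (c N k * z) - R (c N k * w)) \<le> L * cmod (z - w)" for k
      using bnd(4)[OF in_disc in_disc, OF that(2,3), of N k N k]
      by (simp add: right_diff_distrib[symmetric] norm_mult c_def)
    then have "norm (\<Sum>k<N. R (c N k * z) - R (c N k * w)) \<le> (\<Sum>k<N. L * cmod (z - w))"
      by (intro sum_norm_le)
    moreover have "A N z - A N w = (1 / real N) *\<^sub>R (\<Sum>k<N. R (c N k * z) - R (c N k * w))"
      by (simp add: A_def sum_subtractf scaleR_diff_right)
    ultimately show ?thesis using that by (simp add: field_simps)
  qed
  define \<delta> where "\<delta> = 1 / (4 * (L + 1))"
  have \<delta>: "\<delta> > 0" "L * \<delta> \<le> 1 / 4"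
    using bnd(2) by (auto simp: \<delta>_def field_simps)
  have step: "(\<lambda>n. s ^ n * norm (b ^ n)) \<longlonglongrightarrow> 0"
    if t: "(\<lambda>n. t ^ n * norm (b ^ n)) \<longlonglongrightarrow> 0" and ts: "0 \<le> t" "t \<le> s" "s < t'" "t' \<le> t + \<delta>" "t' \<le> r + 1"
    for s t t'
  proof -
    have "(\<lambda>n. M * (t ^ n * norm (b ^ n))) \<longlonglongrightarrow> 0"
      using tendsto_mult_left[OF t, of M] by simp
    then have "eventually (\<lambda>n. M * (t ^ n * norm (b ^ n)) < 1 / 4) sequentially"
      by (rule order_tendstoD) simp
    with eventually_gt_at_top[of 0]
    have "eventually (\<lambda>n. t' ^ n * norm (b ^ n) \<le> 1) sequentially"
    proof eventually_elim
      case (elim n)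
      have disc: "complex_of_real t \<in> cball 0 (r + 1)" "complex_of_real t' \<in> cball 0 (r + 1)"
        using ts by auto
      define u where "u x = complex_of_real x ^ n *\<^sub>C b ^ n" for x
      have nu: "norm (u x) = x ^ n * norm (b ^ n)" if "x \<ge> 0" for x
        using that by (simp add: u_def norm_scaleC norm_power)
      have uA: "u x * A n (complex_of_real x) = A n (complex_of_real x) - 1" for x
        using A_inv[OF elim(1), of "complex_of_real x"] by (simp add: u_def algebra_simps)
      have "norm (A n t - 1) \<le> norm (u t) * norm (A n t)"
        unfolding uA[symmetric] by (rule norm_mult_ineq)
      also have "\<dots> \<le> norm (u t) * M"
        by (intro mult_left_mono A_bound elim disc) auto
      also have "\<dots> < 1 / 4" using elim ts by (simp add: nu mult_ac)
      finally have 1: "norm (A n t - 1) < 1 / 4" .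
      have "norm (A n t' - A n t) \<le> L * cmod (complex_of_real t' - complex_of_real t)"
        by (intro A_Lip elim disc)
      also have "cmod (complex_of_real t' - complex_of_real t) = t' - t"
        using ts by (simp flip: of_real_diff)
      also have "L * (t' - t) \<le> L * \<delta>"
        using ts bnd by (intro mult_left_mono) auto
      finally have "norm (A n t' - A n t) \<le> 1 / 4" using \<delta> by simp
      with 1 have half: "norm (A n t' - 1) \<le> 1 / 2"
        using norm_triangle_ineq[of "A n t' - A n t" "A n t - 1"] by simp
      have "u t' = (A n t' - 1) - u t' * (A n t' - 1)"
        using uA[of t'] by (simp add: algebra_simps)
      then have "norm (u t') \<le> norm (A n t' - 1) + norm (u t' * (A n t' - 1))"
        by (metis norm_triangle_ineq4)
      also have "norm (u t' * (A n t' - 1)) \<le> norm (u t') * norm (A n t' - 1)"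
        by (rule norm_mult_ineq)
      also have "\<dots> \<le> norm (u t') * (1 / 2)"
        by (intro mult_left_mono half) auto
      finally have "norm (u t') \<le> 1" using half by simp
      then show ?case using ts by (simp add: nu)
    qed
    then have "eventually (\<lambda>n. norm (s ^ n * norm (b ^ n)) \<le> (s / t') ^ n) sequentially"
    proof eventually_elim
      case (elim n)
      have "s ^ n * norm (b ^ n) = (s / t') ^ n * (t' ^ n * norm (b ^ n))"
        using ts by (simp add: power_divide)
      also have "\<dots> \<le> (s / t') ^ n * 1"
        using ts by (intro mult_left_mono elim) auto
      finally show ?case using ts by simp
    qed
    moreover have "(\<lambda>n. (s / t') ^ n) \<longlonglongrightarrow> 0"
      using ts by (intro LIMSEQ_realpow_zero) auto
    ultimately show ?thesis by (rule Lim_null_comparison)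
  qed
  have "(\<lambda>n. min r (real k * (\<delta> / 2)) ^ n * norm (b ^ n)) \<longlonglongrightarrow> 0" for k
  proof (induction k)
    case 0
    have "eventually (\<lambda>n. (0::real) ^ n * norm (b ^ n) = 0) sequentially"
      using eventually_gt_at_top[of 0] by eventually_elim simp
    then show ?case using r by (simp add: min_absorb2 tendsto_eventually)
  next
    case (Suc k)
    define t where "t = min r (real k * (\<delta> / 2))"
    define s where "s = min r (real (Suc k) * (\<delta> / 2))"
    have "0 \<le> t" "t \<le> s" "s \<le> t + \<delta> / 2" "s \<le> r"
      using r \<delta>(1) by (auto simp: t_def s_def min_def field_simps)
    with Suc[folded t_def] \<delta>(1) have "(\<lambda>n. s ^ n * norm (b ^ n)) \<longlonglongrightarrow> 0"
      by (intro step[of t s "min (t + \<delta>) (r + 1)"]) auto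
    then show ?case by (simp add: s_def)
  qed
  moreover obtain k where "r < real k * (\<delta> / 2)"
    using \<delta>(1) ex_less_of_nat_mult[of "\<delta> / 2" r] by auto
  ultimately show ?thesis by (metis less_imp_le min_absorb1)
qed


lemma quasinilpotent_powers:
  fixes v :: "'a::complex_banach_algebra_1"
  assumes v: "\<And>\<mu>. \<mu> \<noteq> 0 \<Longrightarrow> invertible_in UNIV 1 (v - \<mu> *\<^sub>C 1)" and r: "r \<ge> 0"
  shows "(\<lambda>n. r ^ n * norm (v ^ n)) \<longlonglongrightarrow> 0"
proof -
  have "\<exists>y. (1 - z *\<^sub>C v) * y = 1 \<and> y * (1 - z *\<^sub>C v) = 1" for z
  proof (cases "z = 0")
    case False
    then obtain y where "(v - inverse z *\<^sub>C 1) * y = 1" "y * (v - inverse z *\<^sub>C 1) = 1"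
      using v[of "inverse z"] by (auto simp: invertible_in_def)
    moreover have "1 - z *\<^sub>C v = (- z) *\<^sub>C (v - inverse z *\<^sub>C 1)"
      using False by (simp add: scaleC.scale_right_diff_distrib)
    ultimately show ?thesis
      using False by (intro exI[of _ "(- inverse z) *\<^sub>C y"])
        (simp add: mult_scaleC_left mult_scaleC_right)
  qed simp
  then obtain R where "\<And>z. (1 - z *\<^sub>C v) * R z = 1" "\<And>z. R z * (1 - z *\<^sub>C v) = 1"
    by metis
  then show ?thesis using r by (rule powers_vanish_of_resolvent)
qed

text \<open>
  Iteration gives \<open>T = x ^ n * T * v ^ n\<close> (or its mirror image), and the powers of \<open>v\<close> decay faster
  than any geometric growth of the powers of \<open>x\<close>. With \<open>T\<close> an idempotent and \<open>x\<close> a corner inverse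
  of \<open>v\<close> this is nonemptiness of the spectrum; with \<open>T\<close> an off-diagonal block it says that such
  blocks vanish for elements commuting with a generalized Drazin invertible one.
\<close>

lemma quasinilpotent_intertwiner_zero:
  fixes v :: "'a::complex_banach_algebra_1"
  assumes v: "\<And>\<mu>. \<mu> \<noteq> 0 \<Longrightarrow> invertible_in UNIV 1 (v - \<mu> *\<^sub>C 1)"
    and T: "T = x * T * v \<or> T = v * T * x"
  shows "T = 0"
proof -
  have bound: "norm T \<le> norm T * (norm x ^ n * norm (v ^ n))" for n
    using T
  proof
    assume T: "T = x * T * v"
    have "T = x ^ n * T * v ^ n"
    proof (induction n)
      case (Suc n)
      have "x ^ Suc n * T * v ^ Suc n = x ^ n * (x * T * v) * v ^ n"
        by (simp only: power_Suc2[of x] power_Suc[of v] mult.assoc)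
      then show ?case using Suc T by simp
    qed simp
    moreover have "norm (x ^ n * T) \<le> norm x ^ n * norm T"
    proof (induction n)
      case (Suc n)
      have "norm (x * (x ^ n * T)) \<le> norm x * (norm x ^ n * norm T)"
        by (rule order.trans[OF norm_mult_ineq mult_left_mono[OF Suc]]) simp
      then show ?case by (simp add: mult.assoc)
    qed simp
    ultimately have "norm T \<le> norm x ^ n * norm T * norm (v ^ n)"
      by (metis norm_mult_ineq order.trans mult_right_mono norm_ge_zero)
    then show ?thesis by (simp add: mult_ac)
  next
    assume T: "T = v * T * x"
    have "T = v ^ n * T * x ^ n"
    proof (induction n)
      case (Suc n)
      have "v ^ Suc n * T * x ^ Suc n = v ^ n * (v * T * x) * x ^ n"
        by (simp only: power_Suc2[of v] power_Suc[of x] mult.assoc)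
      then show ?case using Suc T by simp
    qed simp
    moreover have "norm (T * x ^ n) \<le> norm x ^ n * norm T"
    proof (induction n)
      case (Suc n)
      have "norm (T * x ^ n * x) \<le> (norm x ^ n * norm T) * norm x"
        by (rule order.trans[OF norm_mult_ineq mult_right_mono[OF Suc]]) simp
      then show ?case by (simp add: mult_ac power_Suc2[of x] del: power_Suc)
        (simp add: mult_ac)
    qed simp
    ultimately have "norm T \<le> norm (v ^ n) * (norm x ^ n * norm T)"
      by (metis norm_mult_ineq order.trans mult_left_mono norm_ge_zero mult.assoc)
    then show ?thesis by (simp add: mult_ac)
  qed
  have "(\<lambda>n. norm T * (norm x ^ n * norm (v ^ n))) \<longlonglongrightarrow> norm T * 0"
    by (intro tendsto_mult_left quasinilpotent_powers v) auto
  then have "norm T \<le> norm T * 0"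
    by (rule LIMSEQ_le_const) (use bound in blast)
  then show ?thesis by simp
qed

section \<open>Corner algebras\<close>

lemma corner_iff:
  assumes "idempotent p"
  shows "b \<in> corner p \<longleftrightarrow> p * b = b \<and> b * p = b"
proof
  assume "b \<in> corner p"
  then obtain y where "b = p * y * p" by (auto simp: corner_def)
  with assms show "p * b = b \<and> b * p = b"
    unfolding idempotent_def by (metis mult.assoc)
next
  assume "p * b = b \<and> b * p = b"
  then have "b = p * b * p" by simp
  then show "b \<in> corner p" unfolding corner_def by (rule range_eqI)
qed

lemma corner_one: "corner 1 = UNIV"
  by (simp add: corner_def)

lemma idempotent_compl: "idempotent p \<Longrightarrow> idempotent (1 - p)"
  by (simp add: idempotent_def algebra_simps)

lemma corner_unit_scaled: "idempotent p \<Longrightarrow> \<mu> *\<^sub>C p \<in> corner p"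
  by (simp add: corner_iff mult_scaleC_left mult_scaleC_right) (simp add: idempotent_def)

lemma mult_idempotent_in_corner:
  "idempotent p \<Longrightarrow> w * p = p * w \<Longrightarrow> w * p \<in> corner p"
  by (simp add: corner_iff idempotent_def) (metis mult.assoc)

lemma complementary_corners_orthogonal:
  assumes "idempotent p" "b \<in> corner p" "c \<in> corner (1 - p)"
  shows "b * c = 0" "c * b = 0"
proof -
  have "b = b * p" "b = p * b" "c * p = 0" "p * c = 0"
    using assms idempotent_compl[OF assms(1)] by (auto simp: corner_iff algebra_simps)
  then show "b * c = 0" "c * b = 0" by (metis mult.assoc mult_zero_left mult_zero_right)+
qed

lemma invertible_unit_scaled:
  "idempotent p \<Longrightarrow> \<mu> \<noteq> 0 \<Longrightarrow> invertible_in (corner p) p (\<mu> *\<^sub>C p)"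
  unfolding invertible_in_def
  by (auto simp: corner_unit_scaled mult_scaleC_left mult_scaleC_right idempotent_def
      intro!: bexI[of _ "inverse \<mu> *\<^sub>C p"])

lemma invertible_cut:
  assumes "invertible_in UNIV 1 w" "idempotent p" "w * p = p * w"
  shows "invertible_in (corner p) p (w * p)"
proof -
  obtain y where y: "w * y = 1" "y * w = 1"
    using assms by (auto simp: invertible_in_def)
  have yp: "y * p = p * y"
    using y assms(3) by (metis mult.assoc mult_1_left mult_1_right)
  have "(w * p) * (y * p) = p" "(y * p) * (w * p) = p"
    using y yp assms(2,3) unfolding idempotent_def by (metis mult.assoc mult_1_left)+
  moreover have "w * p \<in> corner p" "y * p \<in> corner p"
    by (rule mult_idempotent_in_corner[OF assms(2,3)] mult_idempotent_in_corner[OF assms(2) yp])+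
  ultimately show ?thesis
    unfolding invertible_in_def by blast
qed

lemma invertible_glue:
  assumes p: "idempotent p" and b: "invertible_in (corner p) p b"
    and c: "invertible_in (corner (1 - p)) (1 - p) c"
  shows "invertible_in UNIV 1 (b + c)"
proof -
  obtain y where y: "b * y = p" "y * b = p" "b \<in> corner p" "y \<in> corner p"
    using b by (auto simp: invertible_in_def)
  obtain d where d: "c * d = 1 - p" "d * c = 1 - p" "c \<in> corner (1 - p)" "d \<in> corner (1 - p)"
    using c by (auto simp: invertible_in_def)
  have "(b + c) * (y + d) = 1" "(y + d) * (b + c) = 1"
    using y d complementary_corners_orthogonal[OF p] by (simp_all add: algebra_simps)
  then show ?thesis by (auto simp: invertible_in_def)
qed

text \<open>
  For \<open>v\<close> in the corner of \<open>p\<close>, the two summands are the shift of \<open>v\<close> inside that corner and, when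
  \<open>\<mu> \<noteq> 0\<close>, an invertible element of the complementary corner.
\<close>

lemma shift_split:
  "v - \<mu> *\<^sub>C 1 = (v - \<mu> *\<^sub>C p) + (- \<mu>) *\<^sub>C (1 - p)"
  by (simp add: scaleC.scale_right_diff_distrib)

lemma shift_cut:
  "w * p - \<mu> *\<^sub>C p = (w - \<mu> *\<^sub>C 1) * p"
  by (simp add: left_diff_distrib mult_scaleC_left)

text \<open>
  The spectrum of an element of a nonzero corner is nonempty, so having no nonzero spectral value
  already forces \<open>{0}\<close>. If such a \<open>v\<close> had an inverse \<open>y\<close> in the corner, the unit \<open>p = y * p * v\<close>
  would be an intertwiner and hence zero. The zero corner, where \<open>0\<close> is invertible, satisfies
  both sides.
\<close>

lemma qnil_corner:
  assumes p: "idempotent p"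
  shows "qnil (corner p) p =
    {v \<in> corner p. \<forall>\<mu>. \<mu> \<noteq> 0 \<longrightarrow> invertible_in (corner p) p (v - \<mu> *\<^sub>C p)}" (is "_ = ?Q")
proof
  show "qnil (corner p) p \<subseteq> ?Q"
  proof
    fix v assume v: "v \<in> qnil (corner p) p"
    have "invertible_in (corner p) p (v - \<mu> *\<^sub>C p)" if "\<mu> \<noteq> 0" for \<mu>
    proof (cases "corner p = {0}")
      case True
      then have "p = 0" "v = 0"
        using v corner_unit_scaled[OF p, of 1] by (auto simp: qnil_def)
      then show ?thesis using True by (simp add: invertible_in_def)
    qed (use v that in \<open>auto simp: qnil_def alg_spectrum_def\<close>)
    then show "v \<in> ?Q" using v by (auto simp: qnil_def)
  qed
  show "?Q \<subseteq> qnil (corner p) p"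
  proof
    fix v assume v: "v \<in> ?Q"
    have inv: "invertible_in UNIV 1 (v - \<mu> *\<^sub>C 1)" if "\<mu> \<noteq> 0" for \<mu>
      unfolding shift_split[of v \<mu> p]
      using v that
      by (intro invertible_glue[OF p] invertible_unit_scaled idempotent_compl p) (auto simp del: scaleC.scale_minus_left)
    have "corner p = {0}" if iv: "invertible_in (corner p) p v"
    proof -
      obtain y where "y * v = p" "v \<in> corner p" "y \<in> corner p"
        using iv by (auto simp: invertible_in_def)
      then have "p = y * p * v" using p by (simp add: corner_iff)
      then have "p = 0" using quasinilpotent_intertwiner_zero[of v p y] inv by auto
      then show ?thesis by (auto simp: corner_def)
    qed
    then show "v \<in> qnil (corner p) p"
      using v by (auto simp: qnil_def alg_spectrum_def)
  qed
qed

lemma qnil_UNIV: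
  "qnil UNIV 1 = {v. \<forall>\<mu>. \<mu> \<noteq> 0 \<longrightarrow> invertible_in UNIV 1 (v - \<mu> *\<^sub>C (1::'a::complex_banach_algebra_1))}"
  using qnil_corner[of "1::'a"] by (simp add: corner_one idempotent_def)

section \<open>Generalized Drazin invertibility and corners\<close>

text \<open>
  Write \<open>e = w * x\<close>. On the corner of \<open>e\<close> the element \<open>w\<close> is invertible with inverse \<open>x\<close>; on the
  complementary corner it is the quasinilpotent \<open>v\<close>. An off-diagonal block of \<open>y\<close> with respect to
  \<open>e\<close> therefore satisfies \<open>T = x * T * v\<close> or \<open>T = v * T * x\<close> and vanishes, so \<open>y\<close> commutes with
  \<open>e\<close>, and then with the corner inverse \<open>x\<close>.
\<close>

lemma gDrazin_inverse_double_commutant: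
  fixes w :: "'a::complex_banach_algebra_1"
  assumes x: "w * x = x * w" "x * w * x = x" "w - w\<^sup>2 * x \<in> qnil UNIV 1"
    and y: "y * w = w * y"
  shows "y * x = x * y"
proof -
  define e where "e = w * x"
  define v where "v = w - w\<^sup>2 * x"
  have inv: "invertible_in UNIV 1 (v - \<mu> *\<^sub>C 1)" if "\<mu> \<noteq> 0" for \<mu>
    using x(3) that by (simp add: v_def qnil_UNIV)
  have ee: "e * e = e" and we: "w * e = e * w" and xe: "x * e = x" and ex: "e * x = x"
    unfolding e_def using x by (metis mult.assoc)+
  have v: "v = w * (1 - e)" "v = (1 - e) * w"
    using we by (simp_all add: v_def e_def power2_eq_square algebra_simps)
  have ee': "(1 - e) * (1 - e) = 1 - e"
    using ee by (simp add: algebra_simps)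
  have xw: "x * w = e" using x(1) by (simp add: e_def)
  have e1: "e * y * (1 - e) = 0"
  proof (rule quasinilpotent_intertwiner_zero[OF inv])
    have "x * (e * y * (1 - e)) * v = x * e * (y * w) * (1 - e)"
    proof -
      have "(1 - e) * v = w * (1 - e)"
        using v ee' by (metis mult.assoc)
      then show ?thesis using v by (metis mult.assoc)
    qed
    also have "\<dots> = e * y * (1 - e)"
      using xe xw y by (metis mult.assoc)
    finally show "e * y * (1 - e) = x * (e * y * (1 - e)) * v \<or>
      e * y * (1 - e) = v * (e * y * (1 - e)) * x" by simp
  qed
  have e2: "(1 - e) * y * e = 0"
  proof (rule quasinilpotent_intertwiner_zero[OF inv])
    have "v * ((1 - e) * y * e) * x = (1 - e) * (w * y) * (e * x)"
    proof -
      have "v * (1 - e) = (1 - e) * w"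
        using v ee' by (metis mult.assoc)
      then show ?thesis by (metis mult.assoc)
    qed
    also have "\<dots> = (1 - e) * y * e"
      using ex y e_def by (metis mult.assoc)
    finally show "(1 - e) * y * e = x * ((1 - e) * y * e) * v \<or>
      (1 - e) * y * e = v * ((1 - e) * y * e) * x" by simp
  qed
  have ey: "e * y = y * e"
  proof -
    have "e * y = e * y * e" using e1 by (simp add: right_diff_distrib)
    moreover have "y * e = e * y * e" using e2 by (simp add: left_diff_distrib)
    ultimately show ?thesis by simp
  qed
  have "x * y = x * (e * y)" using xe by (metis mult.assoc)
  also have "\<dots> = x * (y * w) * x" by (simp only: ey) (simp only: e_def mult.assoc)
  also have "\<dots> = e * y * x" by (metis y xw mult.assoc)
  also have "\<dots> = y * x" by (simp add: ey mult.assoc ex)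
  finally show ?thesis by simp
qed

text \<open>
  If \<open>x\<close> is a generalized Drazin inverse of \<open>w\<close>, then \<open>x * p\<close> is one of \<open>w * p\<close>, because \<open>p\<close>
  commutes with \<open>x\<close> as well.
\<close>

lemma gDrazin_cut:
  fixes w :: "'a::complex_banach_algebra_1"
  assumes w: "w \<in> gDrazin UNIV 1" and p: "idempotent p" and wp: "w * p = p * w"
  shows "w * p \<in> gDrazin (corner p) p"
proof -
  obtain x where x: "w * x = x * w" "x * w * x = x" "w - w\<^sup>2 * x \<in> qnil UNIV 1"
    using w by (auto simp: gDrazin_def commutant_def)
  have xp: "p * x = x * p"
    using gDrazin_inverse_double_commutant[OF x] wp by simp
  have pp: "p * p = p" "p * (p * z) = p * z" for z
    using p by (simp_all add: idempotent_def mult.assoc[symmetric])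
  have pw: "p * w = w * p" "p * (w * z) = w * (p * z)" for z
    using wp by (simp_all add: mult.assoc[symmetric])
  have px: "p * x = x * p" "p * (x * z) = x * (p * z)" for z
    using xp by (simp_all add: mult.assoc[symmetric])
  define v where "v = w - w\<^sup>2 * x"
  have vp: "v * p = p * v"
    by (simp add: v_def power2_eq_square algebra_simps pw px)
  have cutv: "w * p - (w * p)\<^sup>2 * (x * p) = v * p"
    by (simp add: v_def power2_eq_square algebra_simps pw px pp)
  have "v * p \<in> qnil (corner p) p"
    unfolding qnil_corner[OF p]
  proof (intro CollectI conjI allI impI)
    show "v * p \<in> corner p" using p vp by (rule mult_idempotent_in_corner)
    fix \<mu> :: complex assume "\<mu> \<noteq> 0"
    then have "invertible_in UNIV 1 (v - \<mu> *\<^sub>C 1)"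
      using x(3) by (simp add: qnil_UNIV v_def)
    moreover have "(v - \<mu> *\<^sub>C 1) * p = p * (v - \<mu> *\<^sub>C 1)"
      by (simp add: algebra_simps vp mult_scaleC_left mult_scaleC_right)
    ultimately show "invertible_in (corner p) p (v * p - \<mu> *\<^sub>C p)"
      unfolding shift_cut using p by (intro invertible_cut)
  qed
  moreover have "w * p * (x * p) = x * p * (w * p)"
    by (simp add: mult.assoc pw px pp) (metis mult.assoc x(1))
  moreover have "x * p * (w * p) * (x * p) = x * p"
    using x(2) by (simp add: mult.assoc pw px pp) (metis mult.assoc)
  moreover have "x * p \<in> corner p" "w * p \<in> corner p"
    using p xp wp by (metis mult_idempotent_in_corner)+
  ultimately show ?thesis
    unfolding gDrazin_def commutant_def cutv[symmetric] by blast
qed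

text \<open>
  If \<open>x\<close> is a generalized Drazin inverse of \<open>s\<close> in its corner and \<open>d\<close> is the inverse of \<open>c\<close> in the
  complementary one, then \<open>x + d\<close> is a generalized Drazin inverse of \<open>s + c\<close> and leaves the same
  quasinilpotent remainder as \<open>x\<close>.
\<close>

lemma gDrazin_glue:
  fixes s :: "'a::complex_banach_algebra_1"
  assumes p: "idempotent p" and s: "s \<in> gDrazin (corner p) p"
    and c: "invertible_in (corner (1 - p)) (1 - p) c"
  shows "s + c \<in> gDrazin UNIV 1"
proof -
  obtain x where x: "s \<in> corner p" "x \<in> corner p" "s * x = x * s" "x * s * x = x"
      "s - s\<^sup>2 * x \<in> qnil (corner p) p"
    using s by (auto simp: gDrazin_def commutant_def)
  obtain d where d: "c * d = 1 - p" "d * c = 1 - p" "c \<in> corner (1 - p)" "d \<in> corner (1 - p)"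
    using c by (auto simp: invertible_in_def)
  note orth = complementary_corners_orthogonal[OF p x(1) d(3)]
    complementary_corners_orthogonal[OF p x(1) d(4)]
    complementary_corners_orthogonal[OF p x(2) d(3)]
    complementary_corners_orthogonal[OF p x(2) d(4)]
  have units: "p * s = s" "s * p = s" "p * x = x" "x * p = x"
    "(1 - p) * c = c" "c * (1 - p) = c" "(1 - p) * d = d" "d * (1 - p) = d"
    using x d p idempotent_compl[OF p] by (auto simp: corner_iff)
  have prod: "(s + c) * (x + d) = s * x + (1 - p)" "(x + d) * (s + c) = s * x + (1 - p)"
    by (simp_all add: distrib_left distrib_right orth d x(3))
  have rem: "(s + c) - (s + c)\<^sup>2 * (x + d) = s - s\<^sup>2 * x"
  proof -
    have "(s + c)\<^sup>2 * (x + d) = (s + c) * (s * x + (1 - p))"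
      by (simp only: power2_eq_square mult.assoc prod)
    also have "\<dots> = s\<^sup>2 * x + (s * (1 - p) + (c * s * x + c * (1 - p)))"
      by (simp only: power2_eq_square distrib_left distrib_right mult.assoc add_ac)
    also have "\<dots> = s\<^sup>2 * x + c"
      using units(6)
      by (simp add: mult.assoc[symmetric] orth units right_diff_distrib)
    finally show ?thesis by simp
  qed
  have "(x + d) * (s + c) * (x + d) = x + d"
  proof -
    have "(s * x + (1 - p)) * (x + d) = s * x * x + (s * (x * d) + ((1 - p) * x + (1 - p) * d))"
      by (simp add: distrib_left distrib_right mult.assoc)
    also have "\<dots> = x + d"
    proof -
      have "s * x * x = x" using x(3,4) by simp
      moreover have "(1 - p) * x = 0" by (simp add: left_diff_distrib units)
      ultimately show ?thesis by (simp add: orth units(7))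
    qed
    finally show ?thesis by (simp only: prod)
  qed
  moreover have "(s + c) - (s + c)\<^sup>2 * (x + d) \<in> qnil UNIV 1"
    unfolding rem qnil_UNIV
  proof (intro CollectI allI impI)
    fix \<mu> :: complex assume "\<mu> \<noteq> 0"
    then show "invertible_in UNIV 1 (s - s\<^sup>2 * x - \<mu> *\<^sub>C 1)"
      unfolding shift_split[of "s - s\<^sup>2 * x" \<mu> p]
      using x(5) by (intro invertible_glue[OF p] invertible_unit_scaled idempotent_compl p)
        (auto simp: qnil_corner[OF p] simp del: scaleC.scale_minus_left)
  qed
  moreover have "(s + c) * (x + d) = (x + d) * (s + c)"
    by (simp only: prod)
  ultimately show ?thesis
    unfolding gDrazin_def commutant_def by blast
qed

text \<open>
  Membership in \<open>acc\<close> tests only shifts by \<open>\<mu> \<noteq> 0\<close>, for which the part of \<open>s - \<mu> *\<^sub>C 1\<close> outside the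
  corner is invertible; gluing and cutting do the rest.
\<close>

lemma acc_corner:
  assumes p: "idempotent p"
  shows "acc (corner p) p = corner p \<inter> acc UNIV 1"
proof (intro equalityI subsetI)
  fix s assume s: "s \<in> acc (corner p) p"
  have "s - \<mu> *\<^sub>C 1 \<in> gDrazin UNIV 1" if "\<mu> \<noteq> 0" for \<mu>
    unfolding shift_split[of s \<mu> p]
    using s that by (intro gDrazin_glue[OF p] invertible_unit_scaled idempotent_compl p)
      (auto simp: acc_def simp del: scaleC.scale_minus_left)
  with s show "s \<in> corner p \<inter> acc UNIV 1" by (auto simp: acc_def)
next
  fix s assume s: "s \<in> corner p \<inter> acc UNIV 1"
  then have sp: "s * p = s" "p * s = s" using p by (auto simp: corner_iff)
  have "s - \<mu> *\<^sub>C p \<in> gDrazin (corner p) p" if "\<mu> \<noteq> 0" for \<mu>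
  proof -
    have "(s - \<mu> *\<^sub>C 1) * p \<in> gDrazin (corner p) p"
      using s that p by (intro gDrazin_cut)
        (auto simp: acc_def sp algebra_simps mult_scaleC_left mult_scaleC_right)
    then show ?thesis by (simp add: shift_cut[symmetric] sp)
  qed
  with s show "s \<in> acc (corner p) p" by (auto simp: acc_def)
qed

section \<open>The splitting of an ag-Drazin invertible element\<close>

text \<open>
  The correspondence sends an ag-Drazin inverse \<open>x\<close> to \<open>f = a * x\<close>, and back to the inverse of
  \<open>a * f\<close> in the corner of \<open>f\<close>; under it \<open>a - a\<^sup>2 * x = a * (1 - f)\<close>.
\<close>

lemma agDrazin_iff_splitting:
  fixes a :: "'a::complex_banach_algebra_1"
  shows "a \<in> agDrazin UNIV 1 \<longleftrightarrow> (\<exists>f. idempotent f \<and> a * f = f * a \<and>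
    invertible_in (corner f) f (a * f) \<and> a * (1 - f) \<in> acc UNIV 1)"
proof
  assume "a \<in> agDrazin UNIV 1"
  then obtain x where x: "a * x = x * a" "x * a * x = x" "a - a\<^sup>2 * x \<in> acc UNIV 1"
    by (auto simp: agDrazin_def commutant_def)
  define f where "f = a * x"
  have f: "idempotent f" "a * f = f * a" "x * f = x" "f * x = x"
    unfolding f_def idempotent_def using x by (metis mult.assoc)+
  have "a * f * x = f" "x * (a * f) = f"
    using f x(1) unfolding f_def by (metis mult.assoc)+
  then have "invertible_in (corner f) f (a * f)"
    using mult_idempotent_in_corner[OF f(1,2)] f unfolding invertible_in_def
    by (metis corner_iff)
  moreover have "a * (1 - f) = a - a\<^sup>2 * x"
    by (simp add: f_def power2_eq_square algebra_simps)
  ultimately show "\<exists>f. idempotent f \<and> a * f = f * a \<and>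
    invertible_in (corner f) f (a * f) \<and> a * (1 - f) \<in> acc UNIV 1"
    using f x by metis
next
  assume "\<exists>f. idempotent f \<and> a * f = f * a \<and>
    invertible_in (corner f) f (a * f) \<and> a * (1 - f) \<in> acc UNIV 1"
  then obtain f y where f: "idempotent f" "a * f = f * a" "a * (1 - f) \<in> acc UNIV 1"
    and y: "y \<in> corner f" "a * f * y = f" "y * (a * f) = f"
    by (auto simp: invertible_in_def)
  have fy: "f * y = y" "y * f = y" using f y by (auto simp: corner_iff)
  have ay: "a * y = f" "y * a = f" using y f fy by (metis mult.assoc)+
  have "a - a\<^sup>2 * y = a * (1 - f)"
    by (simp add: power2_eq_square mult.assoc ay right_diff_distrib)
  then show "a \<in> agDrazin UNIV 1"
    using f ay fy by (auto simp: agDrazin_def commutant_def intro!: exI[of _ y])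
qed

text \<open>
  From \<open>f = a * y = z * a\<close> one gets \<open>z * f = z * a * y = f * y\<close>, so the left and right quotients agree
  after multiplication by \<open>f\<close> and form a two-sided inverse in the corner.
\<close>

lemma acc_quasi_polar_iff_splitting:
  fixes a :: "'a::complex_banach_algebra_1"
  shows "acc_quasi_polar a \<longleftrightarrow> (\<exists>f. idempotent f \<and> a * f = f * a \<and>
    invertible_in (corner f) f (a * f) \<and> a * (1 - f) \<in> acc UNIV 1)"
proof -
  have "f \<in> range (\<lambda>x. a * x) \<inter> range (\<lambda>x. x * a) \<longleftrightarrow> invertible_in (corner f) f (a * f)"
    if f: "idempotent f" and af: "a * f = f * a" for f
  proof
    assume "f \<in> range (\<lambda>x. a * x) \<inter> range (\<lambda>x. x * a)"
    then obtain y z where yz: "f = a * y" "f = z * a" by blast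
    have ff: "f * f = f" using f by (simp add: idempotent_def)
    have zy: "z * f = f * y" using yz by (metis mult.assoc)
    have "z * f \<in> corner f"
      using f ff zy by (simp add: corner_iff) (metis mult.assoc)
    moreover have "a * f * (z * f) = f" "z * f * (a * f) = f"
      using zy yz ff af by (metis mult.assoc)+
    ultimately show "invertible_in (corner f) f (a * f)"
      using mult_idempotent_in_corner[OF f af] unfolding invertible_in_def by blast
  next
    assume "invertible_in (corner f) f (a * f)"
    then obtain y where y: "a * f * y = f" "y * (a * f) = f"
      by (auto simp: invertible_in_def)
    then have "f = a * (f * y)" "f = (y * f) * a" using af by (metis mult.assoc)+
    then show "f \<in> range (\<lambda>x. a * x) \<inter> range (\<lambda>x. x * a)" by blast
  qed
  then show ?thesis
    unfolding acc_quasi_polar_def commutant_def by blast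
qed

lemma matrix_form_iff_splitting:
  fixes a :: "'a::complex_banach_algebra_1"
  assumes f: "idempotent f" and af: "a * f = f * a"
  shows "(\<exists>a1 a2. matrix_rep f a a1 0 0 a2 \<and> invertible_in (corner f) f a1 \<and>
      a2 \<in> acc (corner (1 - f)) (1 - f)) \<longleftrightarrow>
    invertible_in (corner f) f (a * f) \<and> a * (1 - f) \<in> acc UNIV 1"
proof -
  have ff: "f * f = f" "f * (f * z) = f * z" for z
    using f by (simp_all add: idempotent_def mult.assoc[symmetric])
  have fa: "f * a = a * f" "f * (a * z) = a * (f * z)" for z
    using af by (simp_all add: mult.assoc[symmetric])
  have entries: "f * a * f = a * f" "f * a * (1 - f) = 0" "(1 - f) * a * f = 0"
      "(1 - f) * a * (1 - f) = a * (1 - f)"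
    by (simp_all add: algebra_simps ff fa)
  have "a * (1 - f) \<in> corner (1 - f)"
    using af by (intro mult_idempotent_in_corner idempotent_compl f) (simp add: algebra_simps)
  then show ?thesis
    unfolding matrix_rep_def entries acc_corner[OF idempotent_compl[OF f]] by auto
qed

lemma invertible_sum_iff_splitting:
  fixes a :: "'a::complex_banach_algebra_1"
  assumes f: "idempotent f" and af: "a * f = f * a"
  shows "invertible_in UNIV 1 (a * f + 1 - f) \<longleftrightarrow> invertible_in (corner f) f (a * f)"
proof
  have ff: "f * f = f" using f by (simp add: idempotent_def)
  assume "invertible_in UNIV 1 (a * f + 1 - f)"
  moreover have "(a * f + 1 - f) * f = a * f" "f * (a * f + 1 - f) = a * f"
    using af ff by (simp_all add: algebra_simps) (metis mult.assoc)+
  ultimately show "invertible_in (corner f) f (a * f)"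
    using invertible_cut[of "a * f + 1 - f" f] f by simp
next
  assume "invertible_in (corner f) f (a * f)"
  moreover have "invertible_in (corner (1 - f)) (1 - f) (1 - f)"
    using invertible_unit_scaled[OF idempotent_compl[OF f], of 1] by simp
  ultimately show "invertible_in UNIV 1 (a * f + 1 - f)"
    using invertible_glue[OF f, of "a * f" "1 - f"] by (simp add: add_diff_eq)
qed

text \<open>
  On the corner of \<open>1 - f\<close> the sum is \<open>a * (1 - f) + (1 - f)\<close>, a shift of an element of \<open>acc\<close> by
  \<open>\<mu> = - 1\<close>; on the corner of \<open>f\<close> it is the invertible \<open>a * f\<close>.
\<close>

lemma splitting_imp_perturbed_gDrazin:
  fixes a :: "'a::complex_banach_algebra_1"
  assumes f: "idempotent f" and af: "a * f = f * a"
    and inv: "invertible_in (corner f) f (a * f)" and acc: "a * (1 - f) \<in> acc UNIV 1"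
  shows "a + (1 - f) \<in> gDrazin UNIV 1"
proof -
  have "a * (1 - f) \<in> corner (1 - f)"
    using af by (intro mult_idempotent_in_corner idempotent_compl f) (simp add: algebra_simps)
  with acc have "a * (1 - f) \<in> acc (corner (1 - f)) (1 - f)"
    by (simp add: acc_corner[OF idempotent_compl[OF f]])
  then have "\<forall>\<mu>. \<mu> \<noteq> 0 \<longrightarrow> a * (1 - f) - \<mu> *\<^sub>C (1 - f) \<in> gDrazin (corner (1 - f)) (1 - f)"
    by (simp add: acc_def)
  from this[rule_format, of "- 1"]
  have "a * (1 - f) + (1 - f) \<in> gDrazin (corner (1 - f)) (1 - f)"
    by (simp add: diff_minus_eq_add[symmetric] del: minus_diff_eq diff_minus_eq_add)
  from gDrazin_glue[OF idempotent_compl[OF f] this, of "a * f"] inv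
  show ?thesis by (simp add: algebra_simps)
qed

text \<open>
  Adding \<open>p\<close> does not change \<open>a\<close> on the corner of \<open>f = 1 - p\<close>, so cutting yields a generalized
  Drazin inverse \<open>x\<close> of \<open>a * f\<close> there. As an ag-Drazin inverse of \<open>a\<close> it leaves the remainder
  \<open>a * p + v\<close> with \<open>v\<close> quasinilpotent in the corner of \<open>f\<close>; a nonzero shift makes the second
  summand invertible, so it can be glued to the shift of \<open>a * p\<close>.
\<close>

lemma perturbed_gDrazin_imp_agDrazin:
  fixes a :: "'a::complex_banach_algebra_1"
  assumes p: "idempotent p" and ap: "a * p = p * a"
    and gD: "a + p \<in> gDrazin UNIV 1" and acc: "a * p \<in> acc UNIV 1"
  shows "a \<in> agDrazin UNIV 1"
proof -
  define f where "f = 1 - p"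
  have f: "idempotent f" "a * f = f * a" "f * f = f" "p = 1 - f" "p * f = 0"
    using p ap idempotent_compl[OF p] by (auto simp: f_def algebra_simps idempotent_def)
  have "(a + p) * f = f * (a + p)"
    using ap by (simp add: f_def algebra_simps)
  from gDrazin_cut[OF gD f(1) this] have "a * f \<in> gDrazin (corner f) f"
    using f(5) by (simp add: distrib_right)
  then obtain x where x: "x \<in> corner f" "a * f * x = x * (a * f)" "x * (a * f) * x = x"
      "a * f - (a * f)\<^sup>2 * x \<in> qnil (corner f) f"
    by (auto simp: gDrazin_def commutant_def)
  have fx: "f * x = x" "x * f = x" using x f by (auto simp: corner_iff)
  have ax: "a * x = x * a" "x * a * x = x"
    using x fx f by (metis mult.assoc)+
  define v where "v = a * f - (a * f)\<^sup>2 * x"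
  have "(a * f)\<^sup>2 * x = a\<^sup>2 * x"
    unfolding power2_eq_square using fx f(2) by (metis mult.assoc)
  then have decomp: "a - a\<^sup>2 * x = a * p + v"
    by (simp add: v_def f_def algebra_simps)
  have "a * p + v - \<mu> *\<^sub>C 1 \<in> gDrazin UNIV 1" if "\<mu> \<noteq> 0" for \<mu>
  proof -
    have "a * p \<in> acc (corner p) p"
      using acc mult_idempotent_in_corner[OF p ap] by (simp add: acc_corner[OF p])
    then have "a * p - \<mu> *\<^sub>C p \<in> gDrazin (corner p) p"
      using that by (simp add: acc_def)
    moreover have "invertible_in (corner f) f (v - \<mu> *\<^sub>C f)"
      using x(4) that by (simp add: v_def qnil_corner[OF f(1)])
    ultimately have "(a * p - \<mu> *\<^sub>C p) + (v - \<mu> *\<^sub>C f) \<in> gDrazin UNIV 1"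
      using gDrazin_glue[OF p] by (simp add: f_def)
    moreover have "(a * p - \<mu> *\<^sub>C p) + (v - \<mu> *\<^sub>C f) = a * p + v - \<mu> *\<^sub>C 1"
      by (simp add: f_def scaleC.scale_right_diff_distrib)
    ultimately show ?thesis by simp
  qed
  then have "a - a\<^sup>2 * x \<in> acc UNIV 1"
    unfolding decomp by (simp add: acc_def)
  with ax show ?thesis by (auto simp: agDrazin_def commutant_def)
qed

theorem theorem1:
  fixes a :: "'a::complex_banach_algebra_1"
  shows "(a \<in> agDrazin UNIV 1 \<longleftrightarrow> acc_quasi_polar a) \<and>
    (a \<in> agDrazin UNIV 1 \<longleftrightarrow>
      (\<exists>p \<in> commutant UNIV a. idempotent p \<and> a + p \<in> gDrazin UNIV 1 \<and> a * p \<in> acc UNIV 1)) \<and>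
    (a \<in> agDrazin UNIV 1 \<longleftrightarrow>
      (\<exists>f \<in> commutant UNIV a. idempotent f \<and>
        (\<exists>a1 a2. matrix_rep f a a1 0 0 a2 \<and> invertible_in (corner f) f a1 \<and>
          a2 \<in> acc (corner (1 - f)) (1 - f)))) \<and>
    (a \<in> agDrazin UNIV 1 \<longleftrightarrow>
      (\<exists>f \<in> commutant UNIV a. idempotent f \<and>
        a * (1 - f) \<in> acc UNIV 1 \<and> invertible_in UNIV 1 (a * f + 1 - f)))"
proof (intro conjI)
  show "a \<in> agDrazin UNIV 1 \<longleftrightarrow> acc_quasi_polar a"
    by (simp only: agDrazin_iff_splitting acc_quasi_polar_iff_splitting)
  show "a \<in> agDrazin UNIV 1 \<longleftrightarrow>
      (\<exists>p \<in> commutant UNIV a. idempotent p \<and> a + p \<in> gDrazin UNIV 1 \<and> a * p \<in> acc UNIV 1)"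
  proof
    assume "a \<in> agDrazin UNIV 1"
    then obtain f where f: "idempotent f" "a * f = f * a"
        "invertible_in (corner f) f (a * f)" "a * (1 - f) \<in> acc UNIV 1"
      by (auto simp: agDrazin_iff_splitting)
    then have "1 - f \<in> commutant UNIV a"
      by (simp add: commutant_def algebra_simps)
    then show "\<exists>p \<in> commutant UNIV a. idempotent p \<and> a + p \<in> gDrazin UNIV 1 \<and> a * p \<in> acc UNIV 1"
      using splitting_imp_perturbed_gDrazin[OF f] idempotent_compl[OF f(1)] f(4) by blast
  qed (auto simp: commutant_def intro: perturbed_gDrazin_imp_agDrazin)
  show "a \<in> agDrazin UNIV 1 \<longleftrightarrow>
      (\<exists>f \<in> commutant UNIV a. idempotent f \<and>
        (\<exists>a1 a2. matrix_rep f a a1 0 0 a2 \<and> invertible_in (corner f) f a1 \<and>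
          a2 \<in> acc (corner (1 - f)) (1 - f)))"
    unfolding agDrazin_iff_splitting commutant_def
    using matrix_form_iff_splitting[of _ a] by blast
  show "a \<in> agDrazin UNIV 1 \<longleftrightarrow>
      (\<exists>f \<in> commutant UNIV a. idempotent f \<and>
        a * (1 - f) \<in> acc UNIV 1 \<and> invertible_in UNIV 1 (a * f + 1 - f))"
    unfolding agDrazin_iff_splitting commutant_def
    using invertible_sum_iff_splitting[of _ a] by blast
qed

end
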